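(* $\left[\int bv\right]^{\gamma}=d(bs)$.
   Context: All sequences are complex sequences $x=(x_k)_{k\ge 1}$; $\omega$ is the space of all of them. $bs=\{x\in\omega:\sup_n|\sum_{k=1}^n x_k|<\infty\}$ and $d(bs)=\{x\in\omega:(k^{-1}x_k)_k\in bs\}$. Define $\int bv=\{x\in\omega:\sum_{k\ge1}|k x_k-(k-1)x_{k-1}|<\infty\}$, where the term for $k=1$ is $|x_1|$. The $\gamma$-dual of $X\subset\omega$ is $X^{\gamma}=\{a\in\omega:(a_kx_k)_k\in bs\text{ for all }x\in X\}$. *)

theory Defs
  imports Complex_Main
begin

text \<open>
  A sequence \<open>(x\<^sub>k)\<close> with \<open>k \<ge> 1\<close> is a function on \<open>nat\<close>; the unused value at \<open>0\<close>
  is fixed to be \<open>0\<close>, so that distinct functions in \<open>omega\<close> are distinct sequences.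
\<close>

definition omega :: "(nat \<Rightarrow> complex) set" where
  "omega = {x. x 0 = 0}"

definition bs :: "(nat \<Rightarrow> complex) set" where
  "bs = {x \<in> omega. bdd_above ((\<lambda>n. cmod (\<Sum>k=1..n. x k)) ` {1..})}"

definition d_space :: "(nat \<Rightarrow> complex) set \<Rightarrow> (nat \<Rightarrow> complex) set" where
  "d_space X = {x \<in> omega. (\<lambda>k. inverse (of_nat k) * x k) \<in> X}"

text \<open>
  The series over \<open>k \<ge> 1\<close> is written with \<open>k = Suc j\<close>; its term for \<open>j = 0\<close> is \<open>cmod (x 1)\<close>.
\<close>

definition int_bv :: "(nat \<Rightarrow> complex) set" where
  "int_bv = {x \<in> omega. summable (\<lambda>j. cmod (of_nat (Suc j) * x (Suc j) - of_nat j * x j))}"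

definition gamma_dual :: "(nat \<Rightarrow> complex) set \<Rightarrow> (nat \<Rightarrow> complex) set" where
  "gamma_dual X = {a \<in> omega. \<forall>x\<in>X. (\<lambda>k. a k * x k) \<in> bs}"

end

theory Submission
  imports Defs
begin

text \<open>
  The sequence \<open>1/k\<close> lies in \<open>int_bv\<close>, which gives one inclusion. For the other, write
  \<open>a\<^sub>k x\<^sub>k = (a\<^sub>k / k) (k x\<^sub>k)\<close> and sum by parts: the first factor has bounded partial sums
  and the second one has bounded variation.
\<close>

lemma sum_mult_by_parts:
  fixes b y :: "nat \<Rightarrow> 'a::comm_ring"
  assumes "y 0 = 0"
  shows "(\<Sum>k=1..n. b k * y k) =
    (\<Sum>k=1..n. b k) * y n - (\<Sum>j<n. (\<Sum>k=1..j. b k) * (y (Suc j) - y j))"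
  using assms by (induction n) (simp_all add: algebra_simps)

text \<open>The factor 2 counts the boundary term and the sum from summation by parts, each at most
  \<open>M\<close> times the total variation of \<open>y\<close>. The bound is uniform in
  \<open>n\<close>.\<close>

lemma norm_sum_mult_le_variation:
  fixes b y :: "nat \<Rightarrow> 'a::{real_normed_algebra, comm_ring}"
  assumes "y 0 = 0"
    and B: "\<And>n. norm (\<Sum>k=1..n. b k) \<le> M"
    and y: "summable (\<lambda>j. norm (y (Suc j) - y j))"
  shows "norm (\<Sum>k=1..n. b k * y k) \<le> 2 * M * (\<Sum>j. norm (y (Suc j) - y j))"
proof -
  let ?S = "\<Sum>j. norm (y (Suc j) - y j)"
  have M: "0 \<le> M"
    using B[of 0] by simp
  have partial: "(\<Sum>j<n. norm (y (Suc j) - y j)) \<le> ?S"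
    by (intro sum_le_suminf y) auto
  \<comment> \<open>Starting from \<open>y 0 = 0\<close>, no value of \<open>y\<close> can exceed
    its total variation in norm.\<close>
  have "norm (y n) = norm (\<Sum>j<n. y (Suc j) - y j)"
    by (simp add: sum_lessThan_telescope \<open>y 0 = 0\<close>)
  also have "\<dots> \<le> ?S"
    using norm_sum partial by (rule order_trans)
  finally have first: "norm ((\<Sum>k=1..n. b k) * y n) \<le> M * ?S"
    by (intro order_trans[OF norm_mult_ineq] mult_mono B M norm_ge_zero)
  have "norm (\<Sum>j<n. (\<Sum>k=1..j. b k) * (y (Suc j) - y j))
      \<le> (\<Sum>j<n. M * norm (y (Suc j) - y j))"
    by (intro sum_norm_le order_trans[OF norm_mult_ineq] mult_right_mono B norm_ge_zero)
  also have "\<dots> \<le> M * ?S"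
    unfolding sum_distrib_left[symmetric] by (intro mult_left_mono partial M)
  finally show ?thesis
    unfolding sum_mult_by_parts[of y, OF \<open>y 0 = 0\<close>]
    using first by (intro order_trans[OF norm_triangle_ineq4]) simp
qed

text \<open>The products \<open>k * inverse k\<close> are 1 for k \<ge> 1 and 0 at 0, since
  \<open>inverse 0 = 0\<close>; only the difference at \<open>j = 0\<close> survives.\<close>

lemma inverse_of_nat_in_int_bv: "(\<lambda>k. inverse (of_nat k)) \<in> int_bv"
proof -
  have "summable (\<lambda>j. cmod (of_nat (Suc j) * inverse (of_nat (Suc j)) - of_nat j * inverse (of_nat j)))"
    by (rule summable_finite[of "{0}"]) (auto simp del: of_nat_Suc)
  then show ?thesis
    by (simp add: int_bv_def omega_def)
qed

theorem theorem3p9: "gamma_dual int_bv = d_space bs"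
proof (intro subset_antisym subsetI)
  fix a assume "a \<in> gamma_dual int_bv"
  then show "a \<in> d_space bs"
    \<comment> \<open>Testing \<open>a\<close> against this one sequence gives exactly the condition
      that defines \<open>d_space bs\<close>.\<close>
    using inverse_of_nat_in_int_bv by (auto simp: gamma_dual_def d_space_def mult.commute)
next
  fix a assume a: "a \<in> d_space bs"
  define b where "b k = inverse (of_nat k) * a k" for k
  have a0: "a 0 = 0" and "b \<in> bs"
    using a by (auto simp: d_space_def omega_def b_def[abs_def])
  then obtain M where M: "\<And>n. n \<ge> 1 \<Longrightarrow> cmod (\<Sum>k=1..n. b k) \<le> M"
    by (auto simp: bs_def bdd_above_def)
  \<comment> \<open>Membership in \<open>bs\<close> bounds only the sums with n \<ge> 1. The empty
    sum needs 0 \<le> M, which follows from the bound at 1.\<close>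
  have B: "cmod (\<Sum>k=1..n. b k) \<le> M" for n
    using M[of n] order_trans[OF norm_ge_zero M[of 1]] by (cases n) auto
  show "a \<in> gamma_dual int_bv"
    unfolding gamma_dual_def
  proof (intro CollectI conjI ballI)
    show "a \<in> omega"
      by (simp add: omega_def a0)
    fix x assume x: "x \<in> int_bv"
    define y where "y k = of_nat k * x k" for k
    have y: "summable (\<lambda>j. norm (y (Suc j) - y j))"
      using x by (simp add: int_bv_def y_def)
    have y0: "y 0 = 0"
      by (simp add: y_def)
    \<comment> \<open>For k \<ge> 1 the factor k cancels; at 0 both sides vanish because
      \<open>a 0 = 0\<close>.\<close>
    have "a k * x k = b k * y k" for k
      by (cases "k = 0") (simp_all add: b_def y_def a0)
    then have "cmod (\<Sum>k=1..n. a k * x k) \<le> 2 * M * (\<Sum>j. norm (y (Suc j) - y j))" for n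
      using norm_sum_mult_le_variation[of y b, OF y0 B y] by simp
    then show "(\<lambda>k. a k * x k) \<in> bs"
      by (auto simp: bs_def omega_def a0 intro!: bdd_aboveI2)
  qed
qed

end
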